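(* Let $(H,\rho)$ be a complete CAT(0) space with the geodesic extension property, and let $A : H \rightrightarrows TH$ be a monotone vector field satisfying the surjectivity condition, with resolvents $J_\lambda$ ($\lambda\ge 0$). Then for every $x \in \overline{\operatorname{dom} A}$ the limit $$S(t)x := \lim_{k\to\infty} J_{t/k}^{k}x$$ exists for every $t\in[0,+\infty)$, and the convergence is uniform in $t$ on each bounded subinterval of $[0,+\infty)$. Moreover, for every $x\in\operatorname{dom}A$, every $t\ge 0$ and every $k\in\mathbb{N}$ (with $k\geq 1$), $$\rho(J_{t/k}^{k}x,\,S(t)x)\le |Ax|\cdot\frac{2t}{\sqrt{k}}.$$
   Context: Geodesics. In a complete CAT(0) space $(H,\rho)$, $\gamma_{x,y}:[0,1]\to H$ denotes the unique geodesic from $x$ to $y$ parametrized with constant speed $\rho(x,y)$; it is called a zero geodesic if $x=y$. For a normalized geodesic $\gamma$ (i.e. parametrized on $[0,1]$ with constant speed), $\zeta(\gamma)=0$ if $\gamma$ is a zero geodesic and $\zeta(\gamma)=1$ otherwise. $H$ has the geodesic extension property if for all $p,q\in H$ there is $\eta:\mathbb{R}\to H$ with $\eta(0)=p$, $\eta(1)=q$ and $\rho(\eta(s),\eta(t))=\rho(p,q)|s-t|$ for all $s,t\in\mathbb{R}$. Tangent spaces. For $q,r\ne p$, the comparison angle $\overline\angle_p(q,r)$ is the angle at $\bar p$ in a Euclidean triangle $\bar p\bar q\bar r$ with the same side lengths as $p,q,r$; set $\overline\angle_p(p,p)=0$ and $\overline\angle_p(p,r)=\overline\angle_p(r,p)=\pi/2$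 for $r\neq p$. The Alexandrov angle of geodesics $\gamma_1,\gamma_2$ issuing from $p$ is $\alpha_p(\gamma_1,\gamma_2)=\lim_{s,t\to0^+}\overline\angle_p(\gamma_1(s),\gamma_2(t))$. $S_p$ is the set of normalized geodesics issuing from $p$, modulo the relation $\alpha_p=0$, with induced metric $\angle_p$. $T_pH=([0,\infty)\times S_p)/\!\sim$, where $(t_1,\gamma_1)\sim(t_2,\gamma_2)$ iff either $t_1\zeta(\gamma_1)=t_2\zeta(\gamma_2)=0$, or $t_1\zeta(\gamma_1)=t_2\zeta(\gamma_2)>0$ and $\gamma_1=\gamma_2$ in $S_p$. The class of $(t,\gamma)$ is written $t\gamma$, and $\gamma$ stands for $1\gamma$. Put $0_p=0\gamma$ (also equal to $t\gamma_{p,p}$), $\|t\gamma\|=\|t\gamma\|_p=t\zeta(\gamma)$, and $g_p(t_1\gamma_1,t_2\gamma_2)=t_1t_2\zeta(\gamma_1)\zeta(\gamma_2)\cos\angle_p(\gamma_1,\gamma_2)$. $TH=\bigcup_{p\in H}T_pH$. Vector fields. A vector field is a set-valued map $A:H\rightrightarrows TH$ with $Ap\subset T_pH$ for all $p$ (possibly empty); $\operatorname{dom}A=\{p: Ap\neq\emptyset\}$. $A$ is monotone if $g_p(\eta,\gamma_{p,q})\le -g_q(\nu,\gamma_{q,p})$ whenever $\eta\in Ap$, $\nu\in Aq$. $A$ satisfies the surjectivity condition if for all $t>0$ and $x\in H$ there is $p\in H$ with $t\rho(p,x)\gamma_{p,x}\in Ap$. For $\lambda>0$, the resolvent is $J_\lambda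 x=\{z\in H:\lambda^{-1}\rho(z,x)\gamma_{z,x}\in Az\}$, which is a singleton for every $x\in H$ when $A$ is monotone with the surjectivity condition, and is then regarded as a map $J_\lambda:H\to H$; $J_0$ is the identity map. $J_\lambda^k$ denotes the $k$-fold composition. $|Ax|=\inf_{x^*\in Ax}\|x^*\|$. *)

theory Defs
  imports "HOL-Analysis.Analysis"
begin

section \<open>Complete CAT(0) spaces\<close>

text \<open>The space \<open>H\<close> is the universe of a type of class \<^class>\<open>complete_space\<close>. A normalized geodesic is a
  constant speed geodesic on \<open>[0,1]\<close>; it is a total function in HOL, so its values off \<open>[0,1]\<close>
  are fixed by \<open>extensional\<close>, which makes the geodesic between two points of a CAT(0) space
  unique as a function.\<close>

definition geodesics_from :: "'a::metric_space \<Rightarrow> (real \<Rightarrow> 'a) set" where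
  "geodesics_from p = {\<gamma> \<in> extensional {0..1}. \<gamma> 0 = p \<and>
     (\<forall>s\<in>{0..1}. \<forall>t\<in>{0..1}. dist (\<gamma> s) (\<gamma> t) = dist (\<gamma> 0) (\<gamma> 1) * \<bar>s - t\<bar>)}"

definition comparison_triangle ::
  "'a::metric_space \<Rightarrow> 'a \<Rightarrow> 'a \<Rightarrow> real^2 \<Rightarrow> real^2 \<Rightarrow> real^2 \<Rightarrow> bool" where
  "comparison_triangle p q r p' q' r' \<longleftrightarrow>
     dist p' q' = dist p q \<and> dist p' r' = dist p r \<and> dist q' r' = dist q r"

text \<open>Any two distinct sides of a geodesic triangle share a vertex, here called \<open>p\<close>, and the
  comparison inequality is trivial for two points of the same side.\<close>

definition CAT0 :: "'a::metric_space itself \<Rightarrow> bool" where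
  "CAT0 (_ :: 'a itself) \<longleftrightarrow>
     (\<forall>x y :: 'a. \<exists>\<gamma>\<in>geodesics_from x. \<gamma> 1 = y) \<and>
     (\<forall>(p::'a) q r p' q' r'. comparison_triangle p q r p' q' r' \<longrightarrow>
        (\<forall>\<alpha>\<in>geodesics_from p. \<forall>\<beta>\<in>geodesics_from p. \<alpha> 1 = q \<and> \<beta> 1 = r \<longrightarrow>
          (\<forall>s\<in>{0..1}. \<forall>t\<in>{0..1}.
             dist (\<alpha> s) (\<beta> t)
               \<le> dist ((1 - s) *\<^sub>R p' + s *\<^sub>R q') ((1 - t) *\<^sub>R p' + t *\<^sub>R r'))))"

definition geodesic_extension_property :: "'a::metric_space itself \<Rightarrow> bool" where
  "geodesic_extension_property (_ :: 'a itself) \<longleftrightarrow>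
     (\<forall>p q :: 'a. \<exists>\<eta> :: real \<Rightarrow> 'a. \<eta> 0 = p \<and> \<eta> 1 = q \<and>
        (\<forall>s t. dist (\<eta> s) (\<eta> t) = dist p q * \<bar>s - t\<bar>))"

definition geodesic :: "'a::metric_space \<Rightarrow> 'a \<Rightarrow> real \<Rightarrow> 'a" where
  "geodesic x y = (THE \<gamma>. \<gamma> \<in> geodesics_from x \<and> \<gamma> 1 = y)"

definition geodesic_zeta :: "(real \<Rightarrow> 'a::metric_space) \<Rightarrow> real" where
  "geodesic_zeta \<gamma> = (if \<gamma> 0 = \<gamma> 1 then 0 else 1)"


section \<open>Tangent spaces\<close>

definition comparison_angle :: "'a::metric_space \<Rightarrow> 'a \<Rightarrow> 'a \<Rightarrow> real" where
  "comparison_angle p q r =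
     (if q = p \<and> r = p then 0
      else if q = p \<or> r = p then pi / 2
      else (THE \<theta>. \<exists>p' q' r'. comparison_triangle p q r p' q' r' \<and>
              \<theta> = arccos ((q' - p') \<bullet> (r' - p') / (norm (q' - p') * norm (r' - p')))))"

definition alexandrov_angle ::
  "'a::metric_space \<Rightarrow> (real \<Rightarrow> 'a) \<Rightarrow> (real \<Rightarrow> 'a) \<Rightarrow> real" where
  "alexandrov_angle p \<gamma>\<^sub>1 \<gamma>\<^sub>2 =
     Lim (at_right 0 \<times>\<^sub>F at_right 0) (\<lambda>(s, t). comparison_angle p (\<gamma>\<^sub>1 s) (\<gamma>\<^sub>2 t))"

definition direction_rel :: "'a::metric_space \<Rightarrow> ((real \<Rightarrow> 'a) \<times> (real \<Rightarrow> 'a)) set" where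
  "direction_rel p = {(\<gamma>\<^sub>1, \<gamma>\<^sub>2). \<gamma>\<^sub>1 \<in> geodesics_from p \<and> \<gamma>\<^sub>2 \<in> geodesics_from p \<and>
     alexandrov_angle p \<gamma>\<^sub>1 \<gamma>\<^sub>2 = 0}"

definition directions :: "'a::metric_space \<Rightarrow> (real \<Rightarrow> 'a) set set" where
  "directions p = geodesics_from p // direction_rel p"

text \<open>Functions on a quotient are defined through \<^const>\<open>the_elem\<close>: the common value on all
  representatives. In a CAT(0) space these values do not depend on the representative.\<close>

definition direction_angle ::
  "'a::metric_space \<Rightarrow> (real \<Rightarrow> 'a) set \<Rightarrow> (real \<Rightarrow> 'a) set \<Rightarrow> real" where
  "direction_angle p u v = the_elem {alexandrov_angle p \<gamma>\<^sub>1 \<gamma>\<^sub>2 | \<gamma>\<^sub>1 \<gamma>\<^sub>2. \<gamma>\<^sub>1 \<in> u \<and> \<gamma>\<^sub>2 \<in> v}"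

definition direction_zeta :: "(real \<Rightarrow> 'a::metric_space) set \<Rightarrow> real" where
  "direction_zeta u = the_elem (geodesic_zeta ` u)"

text \<open>A tangent vector is an equivalence class of pairs \<open>(t, u)\<close> with \<open>t \<ge> 0\<close> and \<open>u\<close> a direction.
  Every representative determines its base point, so that tangent spaces at distinct points
  are disjoint.\<close>

type_synonym 'a tangent_vector = "(real \<times> (real \<Rightarrow> 'a) set) set"

definition tangent_rel ::
  "'a::metric_space \<Rightarrow> ((real \<times> (real \<Rightarrow> 'a) set) \<times> (real \<times> (real \<Rightarrow> 'a) set)) set" where
  "tangent_rel p = {((t\<^sub>1, u\<^sub>1), (t\<^sub>2, u\<^sub>2)).
     t\<^sub>1 \<ge> 0 \<and> u\<^sub>1 \<in> directions p \<and> t\<^sub>2 \<ge> 0 \<and> u\<^sub>2 \<in> directions p \<and>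
     (t\<^sub>1 * direction_zeta u\<^sub>1 = 0 \<and> t\<^sub>2 * direction_zeta u\<^sub>2 = 0 \<or>
      t\<^sub>1 * direction_zeta u\<^sub>1 = t\<^sub>2 * direction_zeta u\<^sub>2 \<and> t\<^sub>2 * direction_zeta u\<^sub>2 > 0 \<and> u\<^sub>1 = u\<^sub>2)}"

definition tangent_space :: "'a::metric_space \<Rightarrow> 'a tangent_vector set" where
  "tangent_space p = ({0..} \<times> directions p) // tangent_rel p"

text \<open>The tangent vector \<open>t\<gamma>\<close> at \<open>p\<close>.\<close>

definition tangent :: "'a::metric_space \<Rightarrow> real \<Rightarrow> (real \<Rightarrow> 'a) \<Rightarrow> 'a tangent_vector" where
  "tangent p t \<gamma> = tangent_rel p `` {(t, direction_rel p `` {\<gamma>})}"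

definition tangent_norm :: "'a::metric_space tangent_vector \<Rightarrow> real" where
  "tangent_norm \<eta> = the_elem {t * direction_zeta u | t u. (t, u) \<in> \<eta>}"

definition tangent_inner ::
  "'a::metric_space \<Rightarrow> 'a tangent_vector \<Rightarrow> 'a tangent_vector \<Rightarrow> real" where
  "tangent_inner p \<eta> \<nu> =
     the_elem {t\<^sub>1 * t\<^sub>2 * direction_zeta u\<^sub>1 * direction_zeta u\<^sub>2 * cos (direction_angle p u\<^sub>1 u\<^sub>2)
       | t\<^sub>1 u\<^sub>1 t\<^sub>2 u\<^sub>2. (t\<^sub>1, u\<^sub>1) \<in> \<eta> \<and> (t\<^sub>2, u\<^sub>2) \<in> \<nu>}"


section \<open>Vector fields and resolvents\<close>

definition vector_field :: "('a::metric_space \<Rightarrow> 'a tangent_vector set) \<Rightarrow> bool" where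
  "vector_field A \<longleftrightarrow> (\<forall>p. A p \<subseteq> tangent_space p)"

definition vf_dom :: "('a::metric_space \<Rightarrow> 'a tangent_vector set) \<Rightarrow> 'a set" where
  "vf_dom A = {p. A p \<noteq> {}}"

definition monotone_field :: "('a::metric_space \<Rightarrow> 'a tangent_vector set) \<Rightarrow> bool" where
  "monotone_field A \<longleftrightarrow> (\<forall>p q. \<forall>\<eta>\<in>A p. \<forall>\<nu>\<in>A q.
     tangent_inner p \<eta> (tangent p 1 (geodesic p q))
       \<le> - tangent_inner q \<nu> (tangent q 1 (geodesic q p)))"

definition surjectivity_condition :: "('a::metric_space \<Rightarrow> 'a tangent_vector set) \<Rightarrow> bool" where
  "surjectivity_condition A \<longleftrightarrow>
     (\<forall>t>0. \<forall>x. \<exists>p. tangent p (t * dist p x) (geodesic p x) \<in> A p)"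

definition resolvent_set :: "('a::metric_space \<Rightarrow> 'a tangent_vector set) \<Rightarrow> real \<Rightarrow> 'a \<Rightarrow> 'a set" where
  "resolvent_set A \<mu> x = {z. tangent z (inverse \<mu> * dist z x) (geodesic z x) \<in> A z}"

text \<open>Only used for \<open>\<mu> \<ge> 0\<close>; for \<open>\<mu> > 0\<close> the set is a singleton when \<open>A\<close> is monotone with the
  surjectivity condition.\<close>

definition resolvent :: "('a::metric_space \<Rightarrow> 'a tangent_vector set) \<Rightarrow> real \<Rightarrow> 'a \<Rightarrow> 'a" where
  "resolvent A \<mu> x = (if \<mu> = 0 then x else the_elem (resolvent_set A \<mu> x))"

definition vf_min_norm :: "('a::metric_space \<Rightarrow> 'a tangent_vector set) \<Rightarrow> 'a \<Rightarrow> real" where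
  "vf_min_norm A x = (INF \<eta>\<in>A x. tangent_norm \<eta>)"

definition resolvent_iterate ::
  "('a::metric_space \<Rightarrow> 'a tangent_vector set) \<Rightarrow> nat \<Rightarrow> real \<Rightarrow> 'a \<Rightarrow> 'a" where
  "resolvent_iterate A k t x = (resolvent A (t / real k) ^^ k) x"

definition vf_semigroup :: "('a::metric_space \<Rightarrow> 'a tangent_vector set) \<Rightarrow> real \<Rightarrow> 'a \<Rightarrow> 'a" where
  "vf_semigroup A t x = lim (\<lambda>k. resolvent_iterate A k t x)"

end

theory Submission
  imports Defs
begin

text \<open>Monotonicity of \<open>A\<close> combined with the CAT(0) law of cosines gives, for
  \<open>z = J\<^sub>\<mu> x\<close> and \<open>w = J\<^sub>\<nu> y\<close>, the inequality
  \<open>(\<mu> + \<nu>) d(z,w)\<^sup>2 \<le> \<mu> d(z,y)\<^sup>2 + \<nu> d(x,w)\<^sup>2 - \<nu> d(x,z)\<^sup>2 - \<mu> d(y,w)\<^sup>2\<close>.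
  For \<open>\<mu> = \<nu>\<close> it makes the resolvents nonexpansive, by the quadrilateral inequality. For
  different parameters it is a recursion for the squared distances of \<open>J\<^sub>\<mu>\<^sup>i x\<close> and
  \<open>J\<^sub>\<nu>\<^sup>j x\<close>, which is solved, as in Kobayashi's proof of the Crandall--Liggett theorem, by
  \<open>|Ax|\<^sup>2 ((i\<mu> - j\<nu>)\<^sup>2 + i\<mu>\<^sup>2 + j\<nu>\<^sup>2)\<close>. With \<open>\<mu> = t/k\<close> and
  \<open>\<nu> = t/m\<close> this is the Cauchy property, and \<open>m \<rightarrow> \<infinity>\<close> gives the rate.\<close>

section \<open>Euclidean comparison and the CAT(0) inequality for squared distances\<close>

text \<open>\<open>CAT0\<close> speaks only about given comparison triangles, so one has to exist
  before the inequality yields anything. It is placed with \<open>p'\<close> at the origin; sides of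
  length 0 at \<open>p\<close> are treated apart because the cosine formula divides by them.\<close>

lemma comparison_triangle_exists:
  fixes p q r :: "'a::metric_space"
  obtains p' q' r' where "comparison_triangle p q r p' q' r'"
proof (cases "q = p \<or> r = p")
  case True
  have 1: "dist (0::real^2) (vector [c, 0]) = \<bar>c\<bar>" for c
    by (simp add: norm_vec_def L2_set_def sum_2)
  show ?thesis
  proof (cases "q = p")
    case True
    have "comparison_triangle p q r 0 0 (vector [dist p r, 0])"
      using True 1 by (simp add: comparison_triangle_def)
    then show ?thesis by (rule that)
  next
    case False
    then have "comparison_triangle p q r 0 (vector [dist p q, 0]) 0"
      using \<open>q = p \<or> r = p\<close> 1 by (simp add: comparison_triangle_def dist_commute)
    then show ?thesis by (rule that)
  qed
next
  case False
  define a b c where "a = dist p q" "b = dist p r" "c = dist q r"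
  have pos: "a > 0" "b > 0" "c \<ge> 0" using False by (auto simp: a_b_c_def)
  have tri: "c \<le> a + b" "a \<le> b + c" "b \<le> a + c"
    unfolding a_b_c_def
    by (metis dist_commute dist_triangle, metis dist_commute dist_triangle, rule dist_triangle)
  \<comment> \<open>The cosine of the angle at \<open>p'\<close> forced by the law of cosines. The
    triangle inequality, as \<open>(a - b)^2 \<le> c^2 \<le> (a + b)^2\<close>, says that it lies in
    [-1, 1].\<close>
  define C where "C = (a\<^sup>2 + b\<^sup>2 - c\<^sup>2) / (2 * a * b)"
  have "c\<^sup>2 \<le> (a + b)\<^sup>2" "(a - b)\<^sup>2 \<le> c\<^sup>2"
    using tri pos by (auto intro: power_mono abs_le_square_iff[THEN iffD1])
  then have "- 1 \<le> C" "C \<le> 1"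
    using pos by (auto simp: C_def field_simps power2_eq_square)
  then have C2: "C\<^sup>2 \<le> 1"
    by (simp add: abs_square_le_1 abs_le_iff)
  define X Y :: "real^2" where "X = vector [a, 0]" "Y = vector [b * C, b * sqrt (1 - C\<^sup>2)]"
  have "norm X = a"
    using pos by (simp add: X_Y_def norm_vec_def L2_set_def sum_2)
  moreover have "norm Y = b"
  proof -
    have "(b * C)\<^sup>2 + (b * sqrt (1 - C\<^sup>2))\<^sup>2 = b\<^sup>2"
      using C2 by (simp add: power_mult_distrib algebra_simps)
    then show ?thesis
      using pos by (simp add: X_Y_def norm_vec_def L2_set_def sum_2)
  qed
  moreover have "norm (X - Y) = c"
  proof -
    have "(a - b * C)\<^sup>2 + (b * sqrt (1 - C\<^sup>2))\<^sup>2 = a\<^sup>2 - 2 * a * b * C + b\<^sup>2"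
      using C2 by (simp add: power_mult_distrib power2_diff algebra_simps)
    also have "\<dots> = c\<^sup>2"
      using pos by (simp add: C_def)
    finally show ?thesis
      using pos by (simp add: X_Y_def norm_vec_def L2_set_def sum_2)
  qed
  ultimately have "comparison_triangle p q r 0 X Y"
    by (simp add: comparison_triangle_def a_b_c_def dist_norm)
  then show ?thesis by (rule that)
qed

text \<open>Polarization removes the inner product, so that only the three side lengths
  remain.\<close>

lemma norm_diff_scaleR_square:
  fixes X Y :: "'b::real_inner"
  shows "(norm (s *\<^sub>R X - t *\<^sub>R Y))\<^sup>2
    = s\<^sup>2 * (norm X)\<^sup>2 + t\<^sup>2 * (norm Y)\<^sup>2
      - s * t * ((norm X)\<^sup>2 + (norm Y)\<^sup>2 - (norm (X - Y))\<^sup>2)"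
proof -
  have "2 * (X \<bullet> Y) = (norm X)\<^sup>2 + (norm Y)\<^sup>2 - (norm (X - Y))\<^sup>2"
    by (simp add: power2_norm_eq_inner inner_diff_left inner_diff_right inner_commute)
  moreover have "(norm (s *\<^sub>R X - t *\<^sub>R Y))\<^sup>2
      = s\<^sup>2 * (norm X)\<^sup>2 + t\<^sup>2 * (norm Y)\<^sup>2 - s * t * (2 * (X \<bullet> Y))"
    unfolding power2_norm_eq_inner
    by (simp add: inner_diff_left inner_diff_right inner_commute power2_eq_square algebra_simps)
  ultimately show ?thesis by simp
qed

text \<open>Moving \<open>p'\<close> to the origin turns the comparison distance into a polynomial
  in \<open>s\<close>, \<open>t\<close> and the side lengths. All later uses of the comparison
  inequality go through this form.\<close>

lemma CAT0_dist_square_le: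
  fixes p :: "'a::metric_space"
  assumes "CAT0 TYPE('a)" "\<alpha> \<in> geodesics_from p" "\<beta> \<in> geodesics_from p"
    and "s \<in> {0..1}" "t \<in> {0..1}"
  shows "(dist (\<alpha> s) (\<beta> t))\<^sup>2 \<le> s\<^sup>2 * (dist p (\<alpha> 1))\<^sup>2 + t\<^sup>2 * (dist p (\<beta> 1))\<^sup>2
    - s * t * ((dist p (\<alpha> 1))\<^sup>2 + (dist p (\<beta> 1))\<^sup>2 - (dist (\<alpha> 1) (\<beta> 1))\<^sup>2)"
proof -
  obtain p' q' r' where T: "comparison_triangle p (\<alpha> 1) (\<beta> 1) p' q' r'"
    by (rule comparison_triangle_exists)
  have "dist (\<alpha> s) (\<beta> t)
      \<le> dist ((1 - s) *\<^sub>R p' + s *\<^sub>R q') ((1 - t) *\<^sub>R p' + t *\<^sub>R r')"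
    using assms T unfolding CAT0_def by blast
  also have "\<dots> = norm (s *\<^sub>R (q' - p') - t *\<^sub>R (r' - p'))"
    by (simp add: dist_norm algebra_simps)
  finally have "(dist (\<alpha> s) (\<beta> t))\<^sup>2 \<le> (norm (s *\<^sub>R (q' - p') - t *\<^sub>R (r' - p')))\<^sup>2"
    by (simp add: power_mono)
  with T show ?thesis
    unfolding norm_diff_scaleR_square
    by (simp add: comparison_triangle_def dist_norm norm_minus_commute)
qed

lemma geodesics_fromD:
  assumes "\<gamma> \<in> geodesics_from p"
  shows "\<gamma> 0 = p" "\<gamma> \<in> extensional {0..1}"
    and "\<lbrakk>s \<in> {0..1}; t \<in> {0..1}\<rbrakk> \<Longrightarrow> dist (\<gamma> s) (\<gamma> t) = dist p (\<gamma> 1) * \<bar>s - t\<bar>"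
    and "s \<in> {0..1} \<Longrightarrow> dist p (\<gamma> s) = s * dist p (\<gamma> 1)"
proof -
  show 0: "\<gamma> 0 = p" "\<gamma> \<in> extensional {0..1}"
    using assms by (auto simp: geodesics_from_def)
  show d: "dist (\<gamma> s) (\<gamma> t) = dist p (\<gamma> 1) * \<bar>s - t\<bar>"
    if "s \<in> {0..1}" "t \<in> {0..1}" for s t
    using assms that 0 by (auto simp: geodesics_from_def)
  show "dist p (\<gamma> s) = s * dist p (\<gamma> 1)" if "s \<in> {0..1}"
    using d[of 0 s] that 0 by auto
qed

text \<open>Lets an interior point of a geodesic serve as an endpoint, hence as a vertex of a
  smaller comparison triangle.\<close>

lemma geodesics_from_shrink:
  assumes "\<gamma> \<in> geodesics_from p" "c \<in> {0..1}"
  shows "restrict (\<lambda>u. \<gamma> (c * u)) {0..1} \<in> geodesics_from p"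
proof -
  have "dist (\<gamma> (c * s)) (\<gamma> (c * t)) = dist (\<gamma> (c * 0)) (\<gamma> (c * 1)) * \<bar>s - t\<bar>"
    if "s \<in> {0..1}" "t \<in> {0..1}" for s t
  proof -
    have "c * s \<in> {0..1}" "c * t \<in> {0..1}"
      using assms that by (auto simp: mult_le_one)
    then have "dist (\<gamma> (c * s)) (\<gamma> (c * t)) = dist p (\<gamma> 1) * \<bar>c * s - c * t\<bar>"
      using geodesics_fromD(3)[OF assms(1)] by blast
    moreover have "dist p (\<gamma> c) = c * dist p (\<gamma> 1)"
      using geodesics_fromD(4) assms by blast
    ultimately show ?thesis
      using assms geodesics_fromD(1)[OF assms(1)]
      by (simp add: abs_mult flip: right_diff_distrib)
  qed
  then show ?thesis
    using geodesics_fromD(1)[OF assms(1)] by (auto simp: geodesics_from_def)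
qed

text \<open>Two geodesics with the same ends span a triangle with a side of length 0, so comparison
  at equal parameters makes them agree on [0, 1], and \<open>extensional\<close> elsewhere. This
  justifies the \<open>THE\<close> in \<open>geodesic\<close>.\<close>

lemma CAT0_geodesic:
  fixes x y :: "'a::metric_space"
  assumes "CAT0 TYPE('a)"
  shows "geodesic x y \<in> geodesics_from x" "geodesic x y 1 = y"
proof -
  obtain \<gamma> where \<gamma>: "\<gamma> \<in> geodesics_from x" "\<gamma> 1 = y"
    using assms unfolding CAT0_def by blast
  have "\<beta> = \<gamma>" if \<beta>: "\<beta> \<in> geodesics_from x" "\<beta> 1 = y" for \<beta>
  proof (rule extensionalityI)
    show "\<beta> \<in> extensional {0..1}" "\<gamma> \<in> extensional {0..1}"
      using \<beta> \<gamma> by (auto dest: geodesics_fromD)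
    fix s :: real assume "s \<in> {0..1}"
    from CAT0_dist_square_le[OF assms \<beta>(1) \<gamma>(1) this this]
    have "(dist (\<beta> s) (\<gamma> s))\<^sup>2 \<le> 0"
      using \<beta> \<gamma> by (simp add: power2_eq_square algebra_simps)
    then show "\<beta> s = \<gamma> s" by simp
  qed
  with \<gamma> have "\<exists>!\<gamma>. \<gamma> \<in> geodesics_from x \<and> \<gamma> 1 = y"
    by metis
  from theI'[OF this] have "geodesic x y \<in> geodesics_from x \<and> geodesic x y 1 = y"
    unfolding geodesic_def .
  then show "geodesic x y \<in> geodesics_from x" "geodesic x y 1 = y"
    by auto
qed

text \<open>The point \<open>m\<close> divides the diagonal \<open>yz\<close> in the ratio of the sides \<open>xy\<close> and \<open>zw\<close>: this choice
  minimizes the bound for the other diagonal obtained by passing through \<open>m\<close>.\<close>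

lemma CAT0_quadrilateral:
  fixes x y z w :: "'a::metric_space"
  assumes "CAT0 TYPE('a)"
  shows "(dist x w)\<^sup>2 + (dist y z)\<^sup>2
    \<le> (dist x z)\<^sup>2 + (dist y w)\<^sup>2 + 2 * dist x y * dist z w"
proof (cases "x = y \<or> z = w")
  case True
  then show ?thesis by (auto simp: dist_commute)
next
  case False
  define a b where "a = dist x y" "b = dist z w"
  have pos: "a > 0" "b > 0" using False by (auto simp: a_b_def)
  define t where "t = a / (a + b)"
  have t: "t \<in> {0..1}" "t > 0" "1 - t > 0"
    using pos by (auto simp: t_def field_simps)
  define m where "m = geodesic y z t"
  \<comment> \<open>Comparison with the whole side from \<open>y\<close> to \<open>v\<close> (second
    parameter 1) is Stewart's formula as an inequality. It is used for \<open>v = x\<close> and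
    \<open>v = w\<close>.\<close>
  have 1: "(dist m v)\<^sup>2 \<le> (1 - t) * (dist y v)\<^sup>2 + t * (dist z v)\<^sup>2
      - t * (1 - t) * (dist y z)\<^sup>2" for v
    using CAT0_dist_square_le[OF assms CAT0_geodesic(1)[OF assms, of y z]
        CAT0_geodesic(1)[OF assms, of y v] t(1), of 1]
    by (simp add: m_def CAT0_geodesic[OF assms] algebra_simps power2_eq_square)
  have "(dist x w)\<^sup>2 \<le> (dist m x + dist m w)\<^sup>2"
    by (intro power_mono dist_triangle3[of x w m, unfolded dist_commute[of _ m]])
      (auto simp: dist_commute)
  \<comment> \<open>Cauchy-Schwarz with weights \<open>t\<close> and \<open>1 - t\<close>: after
    division by these weights the two \<open>dist y z\<close> terms add up to exactly
    \<open>- (dist y z)^2\<close>.\<close>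
  also have "\<dots> \<le> (dist m x)\<^sup>2 / t + (dist m w)\<^sup>2 / (1 - t)"
  proof -
    have "(dist m x)\<^sup>2 / t + (dist m w)\<^sup>2 / (1 - t) - (dist m x + dist m w)\<^sup>2
        = ((1 - t) * dist m x - t * dist m w)\<^sup>2 / (t * (1 - t))"
      using t by (simp add: field_simps power2_eq_square)
    also have "\<dots> \<ge> 0" using t by simp
    finally show ?thesis by simp
  qed
  also have "\<dots> \<le> ((1 - t) * (dist y x)\<^sup>2 + t * (dist z x)\<^sup>2 - t * (1 - t) * (dist y z)\<^sup>2) / t
     + ((1 - t) * (dist y w)\<^sup>2 + t * (dist z w)\<^sup>2 - t * (1 - t) * (dist y z)\<^sup>2) / (1 - t)"
    using t 1 by (intro add_mono divide_right_mono) auto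
  also have "\<dots> = (dist z x)\<^sup>2 + (dist y w)\<^sup>2 - (dist y z)\<^sup>2
      + ((1 - t) / t * a\<^sup>2 + t / (1 - t) * b\<^sup>2)"
    using t by (simp add: field_simps a_b_def dist_commute)
  finally have "(dist x w)\<^sup>2 \<le> (dist z x)\<^sup>2 + (dist y w)\<^sup>2 - (dist y z)\<^sup>2
      + ((1 - t) / t * a\<^sup>2 + t / (1 - t) * b\<^sup>2)" .
  moreover have "(1 - t) / t * a\<^sup>2 + t / (1 - t) * b\<^sup>2 = 2 * a * b"
  proof -
    have "1 - t = b / (a + b)"
      using pos by (simp add: t_def field_simps)
    then have "(1 - t) / t = b / a" "t / (1 - t) = a / b"
      using pos by (auto simp: t_def)
    then show ?thesis
      using pos by (simp add: power2_eq_square)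
  qed
  ultimately show ?thesis
    by (simp add: a_b_def dist_commute)
qed

text \<open>The cosine of the comparison angle by the law of cosines. Division by 0 gives 0 when
  \<open>q = p\<close> or \<open>r = p\<close>, so the bounds -1 and 1 hold there too.\<close>

definition comparison_cos :: "'a::metric_space \<Rightarrow> 'a \<Rightarrow> 'a \<Rightarrow> real" where
  "comparison_cos p q r =
     ((dist p q)\<^sup>2 + (dist p r)\<^sup>2 - (dist q r)\<^sup>2) / (2 * dist p q * dist p r)"

text \<open>By polarization the argument of \<open>arccos\<close> is the same for every comparison
  triangle, so the \<open>THE\<close> in \<open>comparison_angle\<close> has a unique
  candidate.\<close>

lemma comparison_angle_eq_arccos:
  assumes "q \<noteq> p" "r \<noteq> p"
  shows "comparison_angle p q r = arccos (comparison_cos p q r)"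
proof -
  have eq: "(q' - p') \<bullet> (r' - p') / (norm (q' - p') * norm (r' - p')) = comparison_cos p q r"
    if "comparison_triangle p q r p' q' r'" for p' q' r'
  proof -
    have "(q' - p') \<bullet> (r' - p')
      = ((norm (q' - p'))\<^sup>2 + (norm (r' - p'))\<^sup>2 - (norm (q' - r'))\<^sup>2) / 2"
      by (simp add: power2_norm_eq_inner inner_diff_left inner_diff_right inner_commute)
    also have "\<dots> = ((dist p q)\<^sup>2 + (dist p r)\<^sup>2 - (dist q r)\<^sup>2) / 2"
      using that by (simp add: comparison_triangle_def dist_norm norm_minus_commute)
    finally have eq: "(q' - p') \<bullet> (r' - p')
        = ((dist p q)\<^sup>2 + (dist p r)\<^sup>2 - (dist q r)\<^sup>2) / 2" .
    show ?thesis
      unfolding eq comparison_cos_def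
      using that by (simp add: comparison_triangle_def dist_norm[of p'] norm_minus_commute[of p'])
  qed
  obtain p' q' r' where "comparison_triangle p q r p' q' r'"
    by (rule comparison_triangle_exists)
  with eq have "(THE \<theta>. \<exists>p' q' r'. comparison_triangle p q r p' q' r' \<and>
      \<theta> = arccos ((q' - p') \<bullet> (r' - p') / (norm (q' - p') * norm (r' - p'))))
    = arccos (comparison_cos p q r)"
    by (intro the_equality) metis+
  then show ?thesis
    using assms by (simp add: comparison_angle_def)
qed

lemma comparison_cos_bounds: "- 1 \<le> comparison_cos p q r" "comparison_cos p q r \<le> 1"
proof -
  have "(dist q r)\<^sup>2 \<le> (dist p q + dist p r)\<^sup>2"
    by (intro power_mono) (auto simp: dist_triangle3)
  then have "- (2 * dist p q * dist p r) \<le> (dist p q)\<^sup>2 + (dist p r)\<^sup>2 - (dist q r)\<^sup>2"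
    by (simp add: power2_sum)
  then show "- 1 \<le> comparison_cos p q r"
    by (cases "p = q \<or> p = r") (auto simp: comparison_cos_def field_simps)
  have "(dist p q - dist p r)\<^sup>2 \<le> (dist q r)\<^sup>2"
    using dist_triangle[of p q r] dist_triangle[of p r q]
    by (intro abs_le_square_iff[THEN iffD1]) (auto simp: dist_commute)
  then have "(dist p q)\<^sup>2 + (dist p r)\<^sup>2 - (dist q r)\<^sup>2 \<le> 2 * dist p q * dist p r"
    by (simp add: power2_diff)
  then show "comparison_cos p q r \<le> 1"
    by (cases "p = q \<or> p = r") (auto simp: comparison_cos_def field_simps)
qed

text \<open>Comparison angles at \<open>p\<close> shrink with the triangle: the points at
  \<open>s'\<close>, \<open>t'\<close> correspond to points on the sides of the Euclidean triangle
  for \<open>s\<close>, \<open>t\<close>, with the same angle at the vertex, and the true distance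
  is no larger than the Euclidean one.\<close>

lemma comparison_cos_antimono:
  fixes p :: "'a::metric_space"
  assumes cat: "CAT0 TYPE('a)" and \<alpha>: "\<alpha> \<in> geodesics_from p" and \<beta>: "\<beta> \<in> geodesics_from p"
    and nz: "\<alpha> 1 \<noteq> p" "\<beta> 1 \<noteq> p"
    and s: "0 < s'" "s' \<le> s" "s \<le> 1" and t: "0 < t'" "t' \<le> t" "t \<le> 1"
  shows "comparison_cos p (\<alpha> s) (\<beta> t) \<le> comparison_cos p (\<alpha> s') (\<beta> t')"
proof -
  \<comment> \<open>The parameters of the inner points on the geodesics shrunk by \<open>s\<close>
    and \<open>t\<close>.\<close>
  define u v where "u = s' / s" "v = t' / t"
  have uv: "u \<in> {0..1}" "v \<in> {0..1}" "u > 0" "v > 0" "s' = s * u" "t' = t * v"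
    using s t by (auto simp: u_v_def)
  define a b where "a = dist p (\<alpha> s)" "b = dist p (\<beta> t)"
  have ab: "a > 0" "b > 0"
    using nz s t geodesics_fromD(4)[OF \<alpha>, of s] geodesics_fromD(4)[OF \<beta>, of t]
    by (auto simp: a_b_def)
  have s': "dist p (\<alpha> s') = u * a" "dist p (\<beta> t') = v * b"
    using s t uv geodesics_fromD(4)[OF \<alpha>, of s] geodesics_fromD(4)[OF \<alpha>, of s']
      geodesics_fromD(4)[OF \<beta>, of t] geodesics_fromD(4)[OF \<beta>, of t']
    by (simp_all add: a_b_def)
  have "(dist (\<alpha> s') (\<beta> t'))\<^sup>2
      \<le> u\<^sup>2 * a\<^sup>2 + v\<^sup>2 * b\<^sup>2 - u * v * (a\<^sup>2 + b\<^sup>2 - (dist (\<alpha> s) (\<beta> t))\<^sup>2)"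
    using CAT0_dist_square_le[OF cat geodesics_from_shrink[OF \<alpha>, of s]
        geodesics_from_shrink[OF \<beta>, of t] uv(1,2)] s t uv
    by (simp add: a_b_def)
  then have "(u * v) * (a\<^sup>2 + b\<^sup>2 - (dist (\<alpha> s) (\<beta> t))\<^sup>2)
      \<le> (u * a)\<^sup>2 + (v * b)\<^sup>2 - (dist (\<alpha> s') (\<beta> t'))\<^sup>2"
    by (simp add: power_mult_distrib)
  then have "(u * v) * (a\<^sup>2 + b\<^sup>2 - (dist (\<alpha> s) (\<beta> t))\<^sup>2) / (2 * (u * a) * (v * b))
      \<le> ((u * a)\<^sup>2 + (v * b)\<^sup>2 - (dist (\<alpha> s') (\<beta> t'))\<^sup>2) / (2 * (u * a) * (v * b))"
    using ab uv by (intro divide_right_mono) auto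
  then show ?thesis
    using ab uv s' by (simp add: comparison_cos_def flip: a_b_def)
qed

lemma eventually_prod_at_right_0:
  assumes "c > 0" "d > 0"
    and "\<And>s t. \<lbrakk>0 < s; s < c; 0 < t; t < d\<rbrakk> \<Longrightarrow> P (s, t)"
  shows "eventually P (at_right (0::real) \<times>\<^sub>F at_right (0::real))"
  unfolding eventually_prod_filter
proof (intro exI conjI allI impI)
  show "\<forall>\<^sub>F s in at_right (0::real). 0 < s \<and> s < c"
    using assms(1) by (auto simp: eventually_at_right_field)
  show "\<forall>\<^sub>F t in at_right (0::real). 0 < t \<and> t < d"
    using assms(2) by (auto simp: eventually_at_right_field)
qed (use assms(3) in auto)

lemma prod_at_right_0_neq_bot: "at_right (0::real) \<times>\<^sub>F at_right (0::real) \<noteq> bot"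
  by (simp add: prod_filter_eq_bot)

lemma alexandrov_angle_eqI:
  assumes "((\<lambda>(s, t). comparison_angle p (\<gamma>\<^sub>1 s) (\<gamma>\<^sub>2 t)) \<longlongrightarrow> \<theta>)
    (at_right 0 \<times>\<^sub>F at_right 0)"
  shows "alexandrov_angle p \<gamma>\<^sub>1 \<gamma>\<^sub>2 = \<theta>"
  unfolding alexandrov_angle_def
  using tendsto_Lim[OF prod_at_right_0_neq_bot assms] .

lemma geodesics_from_neq:
  assumes "\<gamma> \<in> geodesics_from p" "\<gamma> 1 \<noteq> p" "0 < s" "s \<le> 1"
  shows "\<gamma> s \<noteq> p"
  using geodesics_fromD(4)[OF assms(1), of s] assms by auto

lemma geodesics_from_zero:
  assumes "\<gamma> \<in> geodesics_from p" "\<gamma> 1 = p" "0 \<le> s" "s \<le> 1"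
  shows "\<gamma> s = p"
  using geodesics_fromD(4)[OF assms(1), of s] assms by auto

text \<open>The conventions for coinciding points make the comparison angle constant near 0. The
  value pi/2 later separates zero geodesics from all others.\<close>

lemma alexandrov_angle_zero_geodesic:
  assumes "\<alpha> \<in> geodesics_from p" "\<beta> \<in> geodesics_from p" "\<alpha> 1 = p \<or> \<beta> 1 = p"
  shows "alexandrov_angle p \<alpha> \<beta> = (if \<alpha> 1 = p \<and> \<beta> 1 = p then 0 else pi / 2)"
proof (rule alexandrov_angle_eqI, rule tendsto_eventually,
    rule eventually_prod_at_right_0[of 1 1])
  fix s t :: real assume "0 < s" "s < 1" "0 < t" "t < 1"
  then have "\<alpha> s = p \<longleftrightarrow> \<alpha> 1 = p" "\<beta> t = p \<longleftrightarrow> \<beta> 1 = p"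
    using geodesics_from_neq geodesics_from_zero assms by (metis less_imp_le)+
  then show "(case (s, t) of (s, t) \<Rightarrow> comparison_angle p (\<alpha> s) (\<beta> t))
      = (if \<alpha> 1 = p \<and> \<beta> 1 = p then 0 else pi / 2)"
    using assms(3) by (auto simp: comparison_angle_def)
qed auto

text \<open>The comparison cosine grows as the parameters decrease, so it converges to its supremum.
  Hence \<open>Lim\<close> in \<open>alexandrov_angle\<close> is a true limit, and the value at the
  endpoints bounds the cosine from below.\<close>

lemma alexandrov_angle_limit:
  fixes p :: "'a::metric_space"
  assumes cat: "CAT0 TYPE('a)" and \<alpha>: "\<alpha> \<in> geodesics_from p" and \<beta>: "\<beta> \<in> geodesics_from p"
    and nz: "\<alpha> 1 \<noteq> p" "\<beta> 1 \<noteq> p"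
  shows "((\<lambda>(s, t). comparison_cos p (\<alpha> s) (\<beta> t)) \<longlongrightarrow> cos (alexandrov_angle p \<alpha> \<beta>))
      (at_right 0 \<times>\<^sub>F at_right 0)"
    and "comparison_cos p (\<alpha> 1) (\<beta> 1) \<le> cos (alexandrov_angle p \<alpha> \<beta>)"
    and "0 \<le> alexandrov_angle p \<alpha> \<beta>" "alexandrov_angle p \<alpha> \<beta> \<le> pi"
proof -
  let ?C = "\<lambda>(s, t). comparison_cos p (\<alpha> s) (\<beta> t)"
  let ?F = "at_right (0::real) \<times>\<^sub>F at_right (0::real)"
  define R :: "(real \<times> real) set" where "R = {0<..1} \<times> {0<..1}"
  define L where "L = Sup (?C ` R)"
  have R: "(1, 1) \<in> R" by (auto simp: R_def)
  have bdd: "bdd_above (?C ` R)"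
    by (rule bdd_aboveI[of _ 1]) (auto simp: comparison_cos_bounds)
  have le_L: "?C z \<le> L" if "z \<in> R" for z
    unfolding L_def using that bdd by (intro cSup_upper) auto
  have L1: "L \<le> 1"
    unfolding L_def using R by (intro cSup_least) (auto simp: comparison_cos_bounds)
  have 11: "comparison_cos p (\<alpha> 1) (\<beta> 1) \<le> L"
    using le_L[OF R] by simp
  then have L0: "- 1 \<le> L"
    using comparison_cos_bounds(1)[of p "\<alpha> 1" "\<beta> 1"] by linarith
  have lim: "(?C \<longlongrightarrow> L) ?F"
  proof (rule order_tendstoI)
    \<comment> \<open>A value above \<open>l\<close> is taken at some \<open>(c, d)\<close>;
      antimonotonicity carries it to all smaller parameters.\<close>
    fix l assume "l < L"
    then obtain z where z: "z \<in> R" "l < ?C z"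
      unfolding L_def using R less_cSup_iff[OF _ bdd] by blast
    obtain c d where cd: "z = (c, d)" by (cases z)
    show "eventually (\<lambda>z. l < ?C z) ?F"
    proof (rule eventually_prod_at_right_0[of c d])
      fix s t assume "0 < s" "s < c" "0 < t" "t < d"
      with z cd comparison_cos_antimono[OF cat \<alpha> \<beta> nz, of s c t d]
      show "l < ?C (s, t)" by (auto simp: R_def)
    qed (use z cd in \<open>auto simp: R_def\<close>)
  next
    fix u assume "L < u"
    show "eventually (\<lambda>z. ?C z < u) ?F"
    proof (rule eventually_prod_at_right_0[of 1 1])
      fix s t :: real assume "0 < s" "s < 1" "0 < t" "t < 1"
      then show "?C (s, t) < u"
        using le_L[of "(s, t)"] \<open>L < u\<close> by (auto simp: R_def)
    qed auto
  qed
  have "((\<lambda>z. arccos (?C z)) \<longlongrightarrow> arccos L) ?F"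
    by (rule continuous_on_tendsto_compose[OF continuous_on_arccos' lim])
      (use L0 L1 in \<open>auto simp: comparison_cos_bounds split: prod.splits\<close>)
  moreover have "eventually (\<lambda>z. arccos (?C z)
      = (\<lambda>(s, t). comparison_angle p (\<alpha> s) (\<beta> t)) z) ?F"
    by (rule eventually_prod_at_right_0[of 1 1])
      (auto simp: comparison_angle_eq_arccos geodesics_from_neq[OF \<alpha>] geodesics_from_neq[OF \<beta>] nz)
  ultimately have "((\<lambda>(s, t). comparison_angle p (\<alpha> s) (\<beta> t)) \<longlongrightarrow> arccos L) ?F"
    by (rule Lim_transform_eventually)
  then have eq: "alexandrov_angle p \<alpha> \<beta> = arccos L"
    by (rule alexandrov_angle_eqI)
  show "(?C \<longlongrightarrow> cos (alexandrov_angle p \<alpha> \<beta>)) ?F"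
    and "comparison_cos p (\<alpha> 1) (\<beta> 1) \<le> cos (alexandrov_angle p \<alpha> \<beta>)"
    and "0 \<le> alexandrov_angle p \<alpha> \<beta>" "alexandrov_angle p \<alpha> \<beta> \<le> pi"
    using lim 11 L0 L1 by (auto simp: eq arccos_lbound arccos_ubound)
qed

lemma geodesic_zeta_eq: "\<gamma> \<in> geodesics_from p \<Longrightarrow> geodesic_zeta \<gamma> = (if \<gamma> 1 = p then 0 else 1)"
  using geodesics_fromD(1) by (fastforce simp: geodesic_zeta_def)

text \<open>The angle is at most the comparison angle at the endpoints; that bound is multiplied
  out. The zeta factors match \<open>tangent_inner\<close>, and with a zero geodesic both sides are
  0.\<close>

lemma CAT0_law_of_cosines:
  fixes p :: "'a::metric_space"
  assumes "CAT0 TYPE('a)" "\<alpha> \<in> geodesics_from p" "\<beta> \<in> geodesics_from p"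
  shows "(dist p (\<alpha> 1))\<^sup>2 + (dist p (\<beta> 1))\<^sup>2 - (dist (\<alpha> 1) (\<beta> 1))\<^sup>2
    \<le> 2 * dist p (\<alpha> 1) * dist p (\<beta> 1)
        * (geodesic_zeta \<alpha> * geodesic_zeta \<beta> * cos (alexandrov_angle p \<alpha> \<beta>))"
proof (cases "\<alpha> 1 = p \<or> \<beta> 1 = p")
  case True
  then show ?thesis by (auto simp: dist_commute)
next
  case False
  then have "dist p (\<alpha> 1) > 0" "dist p (\<beta> 1) > 0" by auto
  then show ?thesis
    using alexandrov_angle_limit(2)[OF assms] False assms
    by (simp add: geodesic_zeta_eq comparison_cos_def field_simps)
qed

text \<open>Expressing the angle through distances at equal arclength makes its invariance under the
  relation of zero angle a consequence of the triangle inequality in the space.\<close>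

lemma dist_at_equal_arclength_limit:
  fixes p :: "'a::metric_space"
  assumes cat: "CAT0 TYPE('a)" and \<alpha>: "\<alpha> \<in> geodesics_from p" and \<beta>: "\<beta> \<in> geodesics_from p"
    and nz: "\<alpha> 1 \<noteq> p" "\<beta> 1 \<noteq> p"
  shows "((\<lambda>r. dist (\<alpha> (r / dist p (\<alpha> 1))) (\<beta> (r / dist p (\<beta> 1))) / r)
    \<longlongrightarrow> sqrt (2 - 2 * cos (alexandrov_angle p \<alpha> \<beta>))) (at_right 0)"
proof -
  define a b where "a = dist p (\<alpha> 1)" "b = dist p (\<beta> 1)"
  have ab: "a > 0" "b > 0" using nz by (auto simp: a_b_def)
  have scale: "filterlim (\<lambda>r. r / c) (at_right 0) (at_right 0)" if "c > 0" for c :: real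
    unfolding filterlim_at
    using that by (auto intro!: tendsto_eq_intros eventually_at_right_less
        eventually_mono[OF eventually_at_right_less[of 0]])
  let ?C = "\<lambda>(s, t). comparison_cos p (\<alpha> s) (\<beta> t)"
  have "filterlim (\<lambda>r. (r / a, r / b)) (at_right 0 \<times>\<^sub>F at_right 0) (at_right 0)"
    using scale ab by (intro filterlim_Pair) auto
  from filterlim_compose[OF alexandrov_angle_limit(1)[OF assms] this]
  have "((\<lambda>r. sqrt (2 - 2 * ?C (r / a, r / b)))
      \<longlongrightarrow> sqrt (2 - 2 * cos (alexandrov_angle p \<alpha> \<beta>))) (at_right 0)"
    by (intro tendsto_intros)
  moreover have "eventually (\<lambda>r. sqrt (2 - 2 * ?C (r / a, r / b))
      = dist (\<alpha> (r / a)) (\<beta> (r / b)) / r) (at_right 0)"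
  proof -
    have "sqrt (2 - 2 * ?C (r / a, r / b)) = dist (\<alpha> (r / a)) (\<beta> (r / b)) / r"
      if r: "0 < r" "r < min a b" for r
    proof -
      have "dist p (\<alpha> (r / a)) = r" "dist p (\<beta> (r / b)) = r"
        using geodesics_fromD(4)[OF \<alpha>, of "r / a"] geodesics_fromD(4)[OF \<beta>, of "r / b"] r ab
        by (auto simp: a_b_def)
      \<comment> \<open>The comparison triangle is isosceles with legs \<open>r\<close>, so its
        cosine is 1 minus half the square of base over leg.\<close>
      then have "2 - 2 * ?C (r / a, r / b) = (dist (\<alpha> (r / a)) (\<beta> (r / b)) / r)\<^sup>2"
        using r by (simp add: comparison_cos_def field_simps power2_eq_square)
      then show ?thesis using r by (simp del: split_conv)
    qed
    then show ?thesis
      using ab by (auto simp: eventually_at_right_field intro!: exI[of _ "min a b"])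
  qed
  ultimately show ?thesis
    unfolding a_b_def[symmetric] by (rule Lim_transform_eventually)
qed

text \<open>Related geodesics are o(r) apart at arclength \<open>r\<close>, so replacing both does
  not change the limit of distance over \<open>r\<close>. This makes \<open>direction_angle\<close>
  well defined on nonzero directions.\<close>

lemma alexandrov_angle_cong:
  fixes p :: "'a::metric_space"
  assumes cat: "CAT0 TYPE('a)"
    and in1: "(\<alpha>, \<alpha>') \<in> direction_rel p" and in2: "(\<beta>, \<beta>') \<in> direction_rel p"
    and nz: "\<alpha> 1 \<noteq> p" "\<alpha>' 1 \<noteq> p" "\<beta> 1 \<noteq> p" "\<beta>' 1 \<noteq> p"
  shows "alexandrov_angle p \<alpha>' \<beta>' = alexandrov_angle p \<alpha> \<beta>"
proof -
  have g: "\<alpha> \<in> geodesics_from p" "\<alpha>' \<in> geodesics_from p" "\<beta> \<in> geodesics_from p"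
    "\<beta>' \<in> geodesics_from p"
    and z: "alexandrov_angle p \<alpha> \<alpha>' = 0" "alexandrov_angle p \<beta> \<beta>' = 0"
    using in1 in2 by (auto simp: direction_rel_def)
  let ?P = "\<lambda>\<gamma> r. \<gamma> (r / dist p (\<gamma> 1))"
  let ?d = "\<lambda>\<gamma> \<delta> r. dist (?P \<gamma> r) (?P \<delta> r) / r"
  note lim = dist_at_equal_arclength_limit[OF cat]
  have 0: "((\<lambda>r. ?d \<alpha> \<alpha>' r + ?d \<beta> \<beta>' r) \<longlongrightarrow> 0) (at_right 0)"
    using tendsto_add[OF lim[OF g(1,2) nz(1,2)] lim[OF g(3,4) nz(3,4)]] z by simp
  have "((\<lambda>r. ?d \<alpha>' \<beta>' r - ?d \<alpha> \<beta> r) \<longlongrightarrow> 0) (at_right 0)"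
  proof (rule Lim_null_comparison[OF _ 0])
    have "norm (?d \<alpha>' \<beta>' r - ?d \<alpha> \<beta> r) \<le> ?d \<alpha> \<alpha>' r + ?d \<beta> \<beta>' r" if "r > 0" for r
    proof -
      let ?A = "?P \<alpha> r" and ?A' = "?P \<alpha>' r" and ?B = "?P \<beta> r" and ?B' = "?P \<beta>' r"
      have "\<bar>dist ?A' ?B' - dist ?A ?B\<bar> \<le> dist ?A ?A' + dist ?B ?B'"
        using dist_triangle[of ?A' ?B' ?A] dist_triangle[of ?A ?B' ?B]
          dist_triangle[of ?A ?B ?A'] dist_triangle[of ?A' ?B ?B']
        by (simp add: dist_commute abs_le_iff)
      then have "\<bar>dist ?A' ?B' - dist ?A ?B\<bar> / r \<le> (dist ?A ?A' + dist ?B ?B') / r"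
        using that by (intro divide_right_mono) auto
      then show ?thesis
        using that by (simp add: add_divide_distrib abs_divide flip: diff_divide_distrib)
    qed
    then show "\<forall>\<^sub>F r in at_right 0. norm (?d \<alpha>' \<beta>' r - ?d \<alpha> \<beta> r) \<le> ?d \<alpha> \<alpha>' r + ?d \<beta> \<beta>' r"
      by (intro eventually_mono[OF eventually_at_right_less[of 0]]) auto
  qed
  with tendsto_diff[OF lim[OF g(2,4) nz(2,4)] lim[OF g(1,3) nz(1,3)]]
  have "sqrt (2 - 2 * cos (alexandrov_angle p \<alpha>' \<beta>'))
      - sqrt (2 - 2 * cos (alexandrov_angle p \<alpha> \<beta>)) = 0"
    by (rule tendsto_unique[rotated]) simp
  \<comment> \<open>Equal roots give equal cosines, and both angles lie in [0, pi], where the cosine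
    is injective.\<close>
  then show ?thesis
    using alexandrov_angle_limit(3,4)[OF cat g(2,4) nz(2,4)]
      alexandrov_angle_limit(3,4)[OF cat g(1,3) nz(1,3)]
    by (simp add: cos_inj_pi)
qed

text \<open>For a nonzero geodesic all these comparison triangles are degenerate, with cosine
  1.\<close>

lemma alexandrov_angle_refl:
  assumes "\<gamma> \<in> geodesics_from p"
  shows "alexandrov_angle p \<gamma> \<gamma> = 0"
proof (cases "\<gamma> 1 = p")
  case True
  then show ?thesis using alexandrov_angle_zero_geodesic[OF assms assms] by simp
next
  case False
  show ?thesis
  proof (rule alexandrov_angle_eqI, rule tendsto_eventually,
      rule eventually_prod_at_right_0[of 1 1])
    fix s t :: real assume st: "0 < s" "s < 1" "0 < t" "t < 1"
    define a where "a = dist p (\<gamma> 1)"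
    have a: "a > 0" using False by (simp add: a_def)
    have "dist p (\<gamma> s) = s * a" "dist p (\<gamma> t) = t * a" "dist (\<gamma> s) (\<gamma> t) = a * \<bar>s - t\<bar>"
      using geodesics_fromD(4)[OF assms, of s] geodesics_fromD(4)[OF assms, of t]
        geodesics_fromD(3)[OF assms, of s t] st by (simp_all add: a_def)
    moreover have "(s * a)\<^sup>2 + (t * a)\<^sup>2 - (a * \<bar>s - t\<bar>)\<^sup>2 = 2 * (s * a) * (t * a)"
      by (simp add: power_mult_distrib power2_diff algebra_simps) (simp add: power2_eq_square)
    ultimately have "comparison_cos p (\<gamma> s) (\<gamma> t) = 1"
      using a st by (simp add: comparison_cos_def)
    then show "(case (s, t) of (s, t) \<Rightarrow> comparison_angle p (\<gamma> s) (\<gamma> t)) = 0"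
      using st False assms by (simp add: comparison_angle_eq_arccos geodesics_from_neq)
  qed auto
qed

section \<open>Norm and inner product on classes of directions and tangent vectors\<close>

lemma direction_rel_refl: "\<gamma> \<in> geodesics_from p \<Longrightarrow> (\<gamma>, \<gamma>) \<in> direction_rel p"
  by (simp add: direction_rel_def alexandrov_angle_refl)

text \<open>A zero geodesic has angle pi/2 with every nonzero one, so the relation never mixes the
  two kinds.\<close>

lemma direction_rel_geodesic_zeta:
  assumes "(\<gamma>, \<gamma>') \<in> direction_rel p"
  shows "geodesic_zeta \<gamma>' = geodesic_zeta \<gamma>"
proof -
  have "\<gamma> \<in> geodesics_from p" "\<gamma>' \<in> geodesics_from p" "alexandrov_angle p \<gamma> \<gamma>' = 0"
    using assms by (auto simp: direction_rel_def)
  then show ?thesis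
    using alexandrov_angle_zero_geodesic[of \<gamma> p \<gamma>']
    by (auto simp: geodesic_zeta_eq split: if_splits)
qed

lemma the_elem_eqI:
  assumes "x \<in> S" "\<And>y. y \<in> S \<Longrightarrow> y = x"
  shows "the_elem S = x"
proof -
  have "S = {x}" using assms by blast
  then show ?thesis by simp
qed

lemma direction_zeta_class:
  assumes "\<gamma> \<in> geodesics_from p"
  shows "direction_zeta (direction_rel p `` {\<gamma>}) = geodesic_zeta \<gamma>"
  unfolding direction_zeta_def
proof (rule the_elem_eqI)
  show "geodesic_zeta \<gamma> \<in> geodesic_zeta ` direction_rel p `` {\<gamma>}"
    using direction_rel_refl[OF assms] by blast
qed (use direction_rel_geodesic_zeta in blast)

lemma direction_angle_class:
  fixes p :: "'a::metric_space"
  assumes cat: "CAT0 TYPE('a)" and g: "\<alpha> \<in> geodesics_from p" "\<beta> \<in> geodesics_from p"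
    and nz: "\<alpha> 1 \<noteq> p" "\<beta> 1 \<noteq> p"
  shows "direction_angle p (direction_rel p `` {\<alpha>}) (direction_rel p `` {\<beta>})
    = alexandrov_angle p \<alpha> \<beta>"
  unfolding direction_angle_def
proof (rule the_elem_eqI)
  fix y assume "y \<in> {alexandrov_angle p \<gamma>\<^sub>1 \<gamma>\<^sub>2 |\<gamma>\<^sub>1 \<gamma>\<^sub>2.
      \<gamma>\<^sub>1 \<in> direction_rel p `` {\<alpha>} \<and> \<gamma>\<^sub>2 \<in> direction_rel p `` {\<beta>}}"
  then obtain \<alpha>' \<beta>' where y: "y = alexandrov_angle p \<alpha>' \<beta>'"
    and rel: "(\<alpha>, \<alpha>') \<in> direction_rel p" "(\<beta>, \<beta>') \<in> direction_rel p"
    by blast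
  then have "\<alpha>' \<in> geodesics_from p" "\<beta>' \<in> geodesics_from p"
    by (auto simp: direction_rel_def)
  then have "\<alpha>' 1 \<noteq> p" "\<beta>' 1 \<noteq> p"
    using direction_rel_geodesic_zeta[OF rel(1)] direction_rel_geodesic_zeta[OF rel(2)] nz g
    by (auto simp: geodesic_zeta_eq split: if_splits)
  then show "y = alexandrov_angle p \<alpha> \<beta>"
    unfolding y by (intro alexandrov_angle_cong[OF cat rel]) (use nz in auto)
qed (use g direction_rel_refl in blast)

lemma tangent_self:
  assumes "\<gamma> \<in> geodesics_from p" "t \<ge> 0"
  shows "(t, direction_rel p `` {\<gamma>}) \<in> tangent p t \<gamma>"
proof -
  have "direction_rel p `` {\<gamma>} \<in> directions p"
    using assms by (auto simp: directions_def intro: quotientI)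
  moreover have "geodesic_zeta \<gamma> \<ge> 0" by (simp add: geodesic_zeta_def)
  ultimately show ?thesis
    using assms by (auto simp: tangent_def tangent_rel_def direction_zeta_class
        zero_less_mult_iff geodesic_zeta_def)
qed

text \<open>All pairs whose product with zeta is 0 form one class, the zero vector; a direction can
  be recovered only from a nonzero product.\<close>

lemma tangent_memD:
  assumes "\<gamma> \<in> geodesics_from p" "(s, v) \<in> tangent p t \<gamma>"
  shows "s * direction_zeta v = t * geodesic_zeta \<gamma>"
    and "t * geodesic_zeta \<gamma> = 0 \<or> v = direction_rel p `` {\<gamma>}"
  using assms by (auto simp: tangent_def tangent_rel_def direction_zeta_class)

lemma tangent_norm_tangent:
  assumes "\<gamma> \<in> geodesics_from p" "t \<ge> 0"
  shows "tangent_norm (tangent p t \<gamma>) = t * geodesic_zeta \<gamma>"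
  unfolding tangent_norm_def
proof (rule the_elem_eqI)
  show "t * geodesic_zeta \<gamma> \<in> {t' * direction_zeta u |t' u. (t', u) \<in> tangent p t \<gamma>}"
    using tangent_self[OF assms] direction_zeta_class[OF assms(1)] by force
qed (use tangent_memD(1)[OF assms(1)] in blast)

lemma tangent_inner_tangent:
  fixes p :: "'a::metric_space"
  assumes cat: "CAT0 TYPE('a)" and g: "\<alpha> \<in> geodesics_from p" "\<beta> \<in> geodesics_from p"
    and st: "s \<ge> 0" "t \<ge> 0"
  shows "tangent_inner p (tangent p s \<alpha>) (tangent p t \<beta>)
    = s * t * (geodesic_zeta \<alpha> * geodesic_zeta \<beta> * cos (alexandrov_angle p \<alpha> \<beta>))"
    (is "_ = ?r")
proof -
  have eq: "t\<^sub>1 * t\<^sub>2 * direction_zeta u\<^sub>1 * direction_zeta u\<^sub>2 * cos (direction_angle p u\<^sub>1 u\<^sub>2) = ?r"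
    if "(t\<^sub>1, u\<^sub>1) \<in> tangent p s \<alpha>" "(t\<^sub>2, u\<^sub>2) \<in> tangent p t \<beta>" for t\<^sub>1 u\<^sub>1 t\<^sub>2 u\<^sub>2
  proof -
    note D = tangent_memD[OF g(1) that(1)] tangent_memD[OF g(2) that(2)]
    have "t\<^sub>1 * t\<^sub>2 * direction_zeta u\<^sub>1 * direction_zeta u\<^sub>2 * cos (direction_angle p u\<^sub>1 u\<^sub>2)
        = (t\<^sub>1 * direction_zeta u\<^sub>1) * (t\<^sub>2 * direction_zeta u\<^sub>2) * cos (direction_angle p u\<^sub>1 u\<^sub>2)"
      by simp
    also have "\<dots> = (s * geodesic_zeta \<alpha>) * (t * geodesic_zeta \<beta>) * cos (alexandrov_angle p \<alpha> \<beta>)"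
    \<comment> \<open>If one product is 0, both sides vanish whatever the directions; otherwise the
      vectors determine both directions.\<close>
    proof (cases "s * geodesic_zeta \<alpha> = 0 \<or> t * geodesic_zeta \<beta> = 0")
      case False
      then have "u\<^sub>1 = direction_rel p `` {\<alpha>}" "u\<^sub>2 = direction_rel p `` {\<beta>}"
        "\<alpha> 1 \<noteq> p" "\<beta> 1 \<noteq> p"
        using D g by (auto simp: geodesic_zeta_eq)
      then show ?thesis
        using D direction_angle_class[OF cat g] by simp
    qed (use D in auto)
    finally show ?thesis by simp
  qed
  show ?thesis
    unfolding tangent_inner_def
  proof (rule the_elem_eqI)
    show "?r \<in> {t\<^sub>1 * t\<^sub>2 * direction_zeta u\<^sub>1 * direction_zeta u\<^sub>2 * cos (direction_angle p u\<^sub>1 u\<^sub>2)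
       | t\<^sub>1 u\<^sub>1 t\<^sub>2 u\<^sub>2. (t\<^sub>1, u\<^sub>1) \<in> tangent p s \<alpha> \<and> (t\<^sub>2, u\<^sub>2) \<in> tangent p t \<beta>}"
      using eq[OF tangent_self[OF g(1) st(1)] tangent_self[OF g(2) st(2)], symmetric]
        tangent_self[OF g(1) st(1)] tangent_self[OF g(2) st(2)] by blast
  qed (use eq in blast)
qed

lemma tangent_spaceE:
  assumes "\<eta> \<in> tangent_space p"
  obtains t \<gamma> where "\<gamma> \<in> geodesics_from p" "t \<ge> 0" "\<eta> = tangent p t \<gamma>"
  using assms unfolding tangent_space_def directions_def tangent_def
  by (auto elim!: quotientE)

section \<open>Monotonicity in terms of distances\<close>

text \<open>The law of cosines for the vectors that define resolvents, with
  \<open>c = inverse \<mu>\<close>. The factor \<open>dist p r\<close> stands outside because the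
  second vector carries 1 in its place.\<close>

lemma tangent_inner_geodesic_ge:
  fixes p q r :: "'a::metric_space"
  assumes cat: "CAT0 TYPE('a)" and "c \<ge> 0"
  shows "c * ((dist p q)\<^sup>2 + (dist p r)\<^sup>2 - (dist q r)\<^sup>2) \<le> 2 * dist p r
    * tangent_inner p (tangent p (c * dist p q) (geodesic p q)) (tangent p 1 (geodesic p r))"
  using mult_left_mono[OF CAT0_law_of_cosines[OF cat CAT0_geodesic(1)[OF cat, of p q]
      CAT0_geodesic(1)[OF cat, of p r]] assms(2)] assms
  by (simp add: tangent_inner_tangent[OF cat CAT0_geodesic(1)[OF cat] CAT0_geodesic(1)[OF cat]]
      CAT0_geodesic[OF cat] algebra_simps)

text \<open>Monotonicity is applied to the two vectors that membership in the resolvent sets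
  provides. After multiplication by \<open>2 * dist z w\<close> the law of cosines bounds each inner
  product from below by squared distances.\<close>

lemma resolvent_set_inequality:
  fixes x y z w :: "'a::metric_space"
  assumes cat: "CAT0 TYPE('a)" and mono: "monotone_field A" and pos: "\<mu> > 0" "\<nu> > 0"
    and z: "z \<in> resolvent_set A \<mu> x" and w: "w \<in> resolvent_set A \<nu> y"
  shows "(\<mu> + \<nu>) * (dist z w)\<^sup>2 + \<nu> * (dist x z)\<^sup>2 + \<mu> * (dist y w)\<^sup>2
    \<le> \<mu> * (dist y z)\<^sup>2 + \<nu> * (dist x w)\<^sup>2"
proof -
  let ?g = "tangent_inner z (tangent z (inverse \<mu> * dist z x) (geodesic z x))
      (tangent z 1 (geodesic z w))"
  let ?h = "tangent_inner w (tangent w (inverse \<nu> * dist w y) (geodesic w y))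
      (tangent w 1 (geodesic w z))"
  have "?g + ?h \<le> 0"
    using mono z w unfolding monotone_field_def resolvent_set_def by fastforce
  then have "2 * dist z w * (?g + ?h) \<le> 0"
    by (simp add: mult_nonneg_nonpos)
  moreover have "inverse \<mu> * ((dist z x)\<^sup>2 + (dist z w)\<^sup>2 - (dist x w)\<^sup>2) \<le> 2 * dist z w * ?g"
    using pos by (intro tangent_inner_geodesic_ge[OF cat]) auto
  moreover have "inverse \<nu> * ((dist w y)\<^sup>2 + (dist w z)\<^sup>2 - (dist y z)\<^sup>2) \<le> 2 * dist w z * ?h"
    using pos by (intro tangent_inner_geodesic_ge[OF cat]) auto
  ultimately have "inverse \<mu> * ((dist z x)\<^sup>2 + (dist z w)\<^sup>2 - (dist x w)\<^sup>2)
      + inverse \<nu> * ((dist w y)\<^sup>2 + (dist w z)\<^sup>2 - (dist y z)\<^sup>2) \<le> 0"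
    by (simp add: distrib_left dist_commute)
  then show ?thesis
    using pos by (simp add: field_simps dist_commute)
qed

text \<open>Adding the quadrilateral inequality with diagonals \<open>xw\<close> and
  \<open>yz\<close> cancels all squares except that of \<open>dist z w\<close>.\<close>

lemma resolvent_set_nonexpansive:
  fixes x y z w :: "'a::metric_space"
  assumes cat: "CAT0 TYPE('a)" and mono: "monotone_field A" and pos: "\<mu> > 0"
    and z: "z \<in> resolvent_set A \<mu> x" and w: "w \<in> resolvent_set A \<mu> y"
  shows "dist z w \<le> dist x y"
proof -
  have "\<mu> * (2 * (dist z w)\<^sup>2 + (dist x z)\<^sup>2 + (dist y w)\<^sup>2)
      \<le> \<mu> * ((dist y z)\<^sup>2 + (dist x w)\<^sup>2)"
    using resolvent_set_inequality[OF cat mono pos pos z w] by (simp add: algebra_simps)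
  then have "2 * (dist z w)\<^sup>2 + (dist x z)\<^sup>2 + (dist y w)\<^sup>2 \<le> (dist y z)\<^sup>2 + (dist x w)\<^sup>2"
    using pos by simp
  then have "dist z w * dist z w \<le> dist x y * dist z w"
    using CAT0_quadrilateral[OF cat, of x w y z] by (simp add: power2_eq_square)
  then show ?thesis
    by (cases "z = w") auto
qed

section \<open>Resolvents of a monotone vector field\<close>

context
  fixes A :: "'a::metric_space \<Rightarrow> 'a tangent_vector set"
  assumes cat: "CAT0 TYPE('a)"
    and field: "vector_field A"
    and mono: "monotone_field A"
    and surj: "surjectivity_condition A"
begin

text \<open>Existence is surjectivity with \<open>t = inverse \<mu>\<close>; uniqueness is
  nonexpansiveness for two candidates with the same \<open>x\<close>. So \<open>the_elem\<close>
  returns an actual resolvent point.\<close>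

lemma resolvent_in_resolvent_set:
  assumes "\<mu> > 0"
  shows "resolvent A \<mu> x \<in> resolvent_set A \<mu> x"
proof -
  obtain z where z: "z \<in> resolvent_set A \<mu> x"
    using surj[unfolded surjectivity_condition_def, rule_format, of "inverse \<mu>" x] assms
    unfolding resolvent_set_def by auto
  have "the_elem (resolvent_set A \<mu> x) = z"
    by (rule the_elem_eqI[OF z])
      (use resolvent_set_nonexpansive[OF cat mono assms _ z, of _ x] in force)
  then show ?thesis
    using z assms by (simp add: resolvent_def)
qed

lemma resolvent_nonexpansive:
  assumes "\<mu> \<ge> 0"
  shows "dist (resolvent A \<mu> x) (resolvent A \<mu> y) \<le> dist x y"
proof (cases "\<mu> = 0")
  case False
  with assms show ?thesis
    by (intro resolvent_set_nonexpansive[OF cat mono, of \<mu>] resolvent_in_resolvent_set) auto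
qed (simp add: resolvent_def)

lemma resolvent_power_nonexpansive:
  assumes "\<mu> \<ge> 0"
  shows "dist ((resolvent A \<mu> ^^ k) x) ((resolvent A \<mu> ^^ k) y) \<le> dist x y"
  by (induction k) (auto intro: order_trans[OF resolvent_nonexpansive[OF assms]])

text \<open>Monotonicity between \<open>\<eta>\<close> at \<open>x\<close> and the resolvent vector
  at \<open>z\<close>: the latter pairs with the direction to \<open>x\<close> to at least
  \<open>dist z x / \<mu>\<close> when \<open>z\<close> differs from \<open>x\<close>, the former to
  at least minus its norm.\<close>

lemma dist_resolvent_le_norm:
  assumes "\<mu> > 0" and \<eta>: "\<eta> \<in> A x"
  shows "dist x (resolvent A \<mu> x) \<le> \<mu> * tangent_norm \<eta>"
proof -
  define z where "z = resolvent A \<mu> x"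
  obtain t \<gamma> where \<gamma>: "\<gamma> \<in> geodesics_from x" "t \<ge> 0" "\<eta> = tangent x t \<gamma>"
    using field \<eta> unfolding vector_field_def by (meson subsetD tangent_spaceE)
  let ?g = "tangent_inner x \<eta> (tangent x 1 (geodesic x z))"
  let ?h = "tangent_inner z (tangent z (inverse \<mu> * dist z x) (geodesic z x))
      (tangent z 1 (geodesic z x))"
  have "?g + ?h \<le> 0"
    using mono \<eta> resolvent_in_resolvent_set[OF assms(1), of x]
    unfolding monotone_field_def resolvent_set_def z_def by fastforce
  \<comment> \<open>Cauchy-Schwarz against a vector of norm at most 1.\<close>
  moreover have "- tangent_norm \<eta> \<le> ?g"
  proof -
    have "- 1 \<le> geodesic_zeta (geodesic x z) * cos (alexandrov_angle x \<gamma> (geodesic x z))"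
      by (simp add: geodesic_zeta_def)
    then have "tangent_norm \<eta> * (- 1) \<le> tangent_norm \<eta>
        * (geodesic_zeta (geodesic x z) * cos (alexandrov_angle x \<gamma> (geodesic x z)))"
      using \<gamma> by (intro mult_left_mono) (auto simp: tangent_norm_tangent geodesic_zeta_def)
    then show ?thesis
      using \<gamma> by (simp add: tangent_inner_tangent[OF cat] CAT0_geodesic[OF cat]
          tangent_norm_tangent mult.assoc)
  qed
  ultimately have "2 * dist z x * ?h \<le> 2 * dist z x * tangent_norm \<eta>"
    by (intro mult_left_mono) auto
  \<comment> \<open>Here both geodesics from \<open>z\<close> end at \<open>x\<close>, so the third
    side has length 0.\<close>
  moreover have "inverse \<mu> * ((dist z x)\<^sup>2 + (dist z x)\<^sup>2 - (dist x x)\<^sup>2) \<le> 2 * dist z x * ?h"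
    using assms by (intro tangent_inner_geodesic_ge[OF cat]) auto
  ultimately have "inverse \<mu> * ((dist z x)\<^sup>2 + (dist z x)\<^sup>2 - (dist x x)\<^sup>2)
      \<le> 2 * dist z x * tangent_norm \<eta>"
    by linarith
  then have "dist z x * dist z x \<le> \<mu> * tangent_norm \<eta> * dist z x"
    using assms by (simp add: field_simps power2_eq_square)
  moreover have "\<mu> * tangent_norm \<eta> \<ge> 0"
    using \<gamma> assms by (simp add: tangent_norm_tangent geodesic_zeta_def)
  ultimately show ?thesis
    by (cases "z = x") (auto simp: dist_commute simp flip: z_def)
qed

lemma vf_min_norm_nonneg:
  assumes "x \<in> vf_dom A"
  shows "vf_min_norm A x \<ge> 0"
  unfolding vf_min_norm_def
proof (rule cINF_greatest)
  fix \<eta> assume "\<eta> \<in> A x"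
  then obtain t \<gamma> where "\<gamma> \<in> geodesics_from x" "t \<ge> 0" "\<eta> = tangent x t \<gamma>"
    using field unfolding vector_field_def by (meson subsetD tangent_spaceE)
  then show "0 \<le> tangent_norm \<eta>"
    by (simp add: tangent_norm_tangent geodesic_zeta_def)
qed (use assms in \<open>auto simp: vf_dom_def\<close>)

lemma dist_resolvent_le:
  assumes "\<mu> > 0" "x \<in> vf_dom A"
  shows "dist x (resolvent A \<mu> x) \<le> \<mu> * vf_min_norm A x"
proof -
  have "dist x (resolvent A \<mu> x) / \<mu> \<le> vf_min_norm A x"
    unfolding vf_min_norm_def
    by (rule cINF_greatest)
      (use assms dist_resolvent_le_norm in \<open>auto simp: vf_dom_def field_simps\<close>)
  then show ?thesis
    using assms by (simp add: field_simps)
qed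

text \<open>Each induction step adds one resolvent step from \<open>x\<close>; the remaining
  distance compares the images of \<open>x\<close> and of the previous iterate under one
  nonexpansive map.\<close>

lemma dist_resolvent_power_le:
  assumes "\<mu> > 0" "x \<in> vf_dom A"
  shows "dist x ((resolvent A \<mu> ^^ k) x) \<le> real k * \<mu> * vf_min_norm A x"
proof (induction k)
  case (Suc k)
  have "dist x ((resolvent A \<mu> ^^ Suc k) x)
      \<le> dist x (resolvent A \<mu> x) + dist (resolvent A \<mu> x) ((resolvent A \<mu> ^^ Suc k) x)"
    by (rule dist_triangle)
  also have "\<dots> \<le> \<mu> * vf_min_norm A x + dist x ((resolvent A \<mu> ^^ k) x)"
    using assms by (intro add_mono dist_resolvent_le) (auto intro: resolvent_nonexpansive)
  finally show ?case
    using Suc by (simp add: algebra_simps)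
qed simp

section \<open>The two-parameter estimate and convergence of the iterates\<close>

text \<open>Induction on \<open>i + j\<close>: the linear growth bound covers the boundary of the
  index grid, and inside it the recursion reduces \<open>(i, j)\<close> to a weighted mean of its
  two predecessors.\<close>

lemma dist_resolvent_powers_square_le:
  assumes pos: "\<mu> > 0" "\<nu> > 0" and x: "x \<in> vf_dom A"
  shows "(dist ((resolvent A \<mu> ^^ i) x) ((resolvent A \<nu> ^^ j) x))\<^sup>2
    \<le> (vf_min_norm A x)\<^sup>2 * ((real i * \<mu> - real j * \<nu>)\<^sup>2 + real i * \<mu>\<^sup>2 + real j * \<nu>\<^sup>2)"
proof (induction "i + j" arbitrary: i j)
  case 0
  then show ?case by simp
next
  case (Suc n)
  define L where "L = vf_min_norm A x"
  let ?d = "\<lambda>i j. (dist ((resolvent A \<mu> ^^ i) x) ((resolvent A \<nu> ^^ j) x))\<^sup>2"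
  let ?b = "\<lambda>i j. L\<^sup>2 * ((real i * \<mu> - real j * \<nu>)\<^sup>2 + real i * \<mu>\<^sup>2 + real j * \<nu>\<^sup>2)"
  have "?d i j \<le> ?b i j"
  proof (cases "i = 0 \<or> j = 0")
    case True
    \<comment> \<open>One index is 0, so one term vanishes and the sign between the two does not
      affect the square.\<close>
    have "?d i j \<le> (real i * \<mu> * L + real j * \<nu> * L)\<^sup>2"
      using True dist_resolvent_power_le[OF pos(1) x, of i]
        dist_resolvent_power_le[OF pos(2) x, of j]
      by (intro power_mono) (auto simp: L_def dist_commute)
    also have "\<dots> = L\<^sup>2 * (real i * \<mu> - real j * \<nu>)\<^sup>2"
      using True by (auto simp: power_mult_distrib)
    also have "\<dots> \<le> ?b i j"
      by (intro mult_left_mono) auto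
    finally show ?thesis .
  next
    case False
    then obtain i' j' where ij: "i = Suc i'" "j = Suc j'"
      by (meson not0_implies_Suc)
    have "(\<mu> + \<nu>) * ?d i j \<le> \<mu> * ?d i j' + \<nu> * ?d i' j"
    proof -
      have "\<nu> * (dist ((resolvent A \<mu> ^^ i') x) ((resolvent A \<mu> ^^ i) x))\<^sup>2 \<ge> 0"
        "\<mu> * (dist ((resolvent A \<nu> ^^ j') x) ((resolvent A \<nu> ^^ j) x))\<^sup>2 \<ge> 0"
        using pos by auto
      with resolvent_set_inequality[OF cat mono pos
          resolvent_in_resolvent_set[OF pos(1), of "(resolvent A \<mu> ^^ i') x"]
          resolvent_in_resolvent_set[OF pos(2), of "(resolvent A \<nu> ^^ j') x"]]
      show ?thesis
        by (simp add: ij dist_commute)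
    qed
    also have "\<dots> \<le> \<mu> * ?b i j' + \<nu> * ?b i' j"
      using Suc.hyps(1)[of i j'] Suc.hyps(1)[of i' j] Suc.hyps(2) pos
      by (intro add_mono mult_left_mono) (auto simp: ij L_def)
    \<comment> \<open>With \<open>D = i * \<mu> - j * \<nu>\<close>, passing to the predecessors
      changes the bracket by \<open>2 * D * \<nu>\<close> and \<open>- 2 * D * \<mu>\<close>, which
      cancel under the weights \<open>\<mu>\<close> and \<open>\<nu>\<close>. The bound thus solves
      the recursion with equality.\<close>
    also have "\<dots> = (\<mu> + \<nu>) * ?b i j"
      by (simp add: ij algebra_simps power2_eq_square)
    finally show ?thesis
      using pos by simp
  qed
  then show ?case by (simp add: L_def)
qed

text \<open>Both iterates reach the same total time \<open>t\<close>, so the squared difference of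
  times drops out. The case \<open>t = 0\<close> is separate because the estimate requires positive
  parameters.\<close>

lemma dist_resolvent_iterate_le:
  assumes "t \<ge> 0" "k \<ge> 1" "m \<ge> 1" and x: "x \<in> vf_dom A"
  shows "dist (resolvent_iterate A k t x) (resolvent_iterate A m t x)
    \<le> vf_min_norm A x * t * sqrt (1 / real k + 1 / real m)"
proof (cases "t = 0")
  case True
  have "(resolvent A 0 ^^ n) x = x" for n
    by (induction n) (auto simp: resolvent_def)
  with True show ?thesis by (simp add: resolvent_iterate_def)
next
  case False
  then have "(dist (resolvent_iterate A k t x) (resolvent_iterate A m t x))\<^sup>2
      \<le> (vf_min_norm A x)\<^sup>2 * (real k * (t / real k)\<^sup>2 + real m * (t / real m)\<^sup>2)"
    using dist_resolvent_powers_square_le[of "t / real k" "t / real m" x k m] assms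
    by (simp add: resolvent_iterate_def)
  also have "\<dots> = (vf_min_norm A x * t * sqrt (1 / real k + 1 / real m))\<^sup>2"
  proof -
    have "real n * (t / real n)\<^sup>2 = t\<^sup>2 * (1 / real n)" for n
      by (simp add: power2_eq_square)
    then show ?thesis
      by (simp add: power_mult_distrib distrib_left mult.assoc)
  qed
  finally show ?thesis
    by (rule power2_le_imp_le) (use assms vf_min_norm_nonneg[OF x] in auto)
qed

lemma dist_resolvent_iterate_le_bounded:
  assumes t: "0 \<le> t" "t \<le> T" and n: "n \<ge> 1" "n \<le> k" "n \<le> m" and y: "y \<in> vf_dom A"
  shows "dist (resolvent_iterate A k t x) (resolvent_iterate A m t x)
    \<le> 2 * dist x y + vf_min_norm A y * T * sqrt (2 / real n)"
proof -
  let ?J = "\<lambda>k. resolvent_iterate A k t"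
  have "dist (?J k x) (?J k y) \<le> dist x y" for k
    unfolding resolvent_iterate_def using t by (intro resolvent_power_nonexpansive) auto
  moreover have "dist (?J k y) (?J m y) \<le> vf_min_norm A y * T * sqrt (2 / real n)"
  proof -
    have "1 / real k \<le> 1 / real n" "1 / real m \<le> 1 / real n"
      using n by (auto intro!: divide_left_mono)
    then have "vf_min_norm A y * t * sqrt (1 / real k + 1 / real m)
        \<le> vf_min_norm A y * T * sqrt (2 / real n)"
      using t vf_min_norm_nonneg[OF y] by (intro mult_mono) (auto intro!: real_sqrt_le_mono)
    then show ?thesis
      using dist_resolvent_iterate_le[OF t(1) _ _ y, of k m] n by simp
  qed
  moreover have "dist (?J k x) (?J m x)
      \<le> dist (?J k x) (?J k y) + dist (?J k y) (?J m y) + dist (?J m x) (?J m y)"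
    using dist_triangle[of "?J k x" "?J m x" "?J k y"] dist_triangle[of "?J k y" "?J m x" "?J m y"]
    by (simp add: dist_commute)
  ultimately show ?thesis
    by (smt (verit))
qed

lemma uniformly_Cauchy_resolvent_iterate:
  assumes x: "x \<in> closure (vf_dom A)"
  shows "uniformly_Cauchy_on {0..T} (\<lambda>k t. resolvent_iterate A k t x)"
  unfolding uniformly_Cauchy_on_def
proof (intro allI impI)
  fix e :: real assume e: "e > 0"
  \<comment> \<open>The two copies of \<open>dist x y\<close> use up e/2; the other half is left for
    the rate at \<open>y\<close>.\<close>
  obtain y where y: "y \<in> vf_dom A" "dist x y < e / 4"
    using x e unfolding closure_approachable
    by (metis dist_commute zero_less_divide_iff zero_less_numeral)
  have "(\<lambda>n. vf_min_norm A y * T * sqrt (2 / real n)) \<longlonglongrightarrow> vf_min_norm A y * T * sqrt 0"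
    by (intro tendsto_intros lim_const_over_n)
  then have "eventually (\<lambda>n. vf_min_norm A y * T * sqrt (2 / real n) < e / 2 \<and> n \<ge> 1) sequentially"
    using e by (intro eventually_conj order_tendstoD(2) eventually_ge_at_top) auto
  then obtain n where n: "vf_min_norm A y * T * sqrt (2 / real n) < e / 2" "n \<ge> 1"
    using eventually_happens'[OF sequentially_bot] by blast
  show "\<exists>M. \<forall>t\<in>{0..T}. \<forall>k\<ge>M. \<forall>m\<ge>M.
      dist (resolvent_iterate A k t x) (resolvent_iterate A m t x) < e"
  proof (intro exI ballI allI impI)
    fix t k m assume "t \<in> {0..T}" "k \<ge> n" "m \<ge> n"
    then show "dist (resolvent_iterate A k t x) (resolvent_iterate A m t x) < e"
      using dist_resolvent_iterate_le_bounded[of t T n k m y x] n y by simp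
  qed
qed

end

theorem theorem5p2:
  fixes A :: "'a::complete_space \<Rightarrow> 'a tangent_vector set"
  assumes "CAT0 TYPE('a)"
    and "geodesic_extension_property TYPE('a)"
    and "vector_field A"
    and "monotone_field A"
    and "surjectivity_condition A"
  shows "(\<forall>x\<in>closure (vf_dom A).
            (\<forall>t\<ge>0. convergent (\<lambda>k. resolvent_iterate A k t x)) \<and>
            (\<forall>I. I \<subseteq> {0..} \<and> is_interval I \<and> bounded I \<longrightarrow>
               uniform_limit I (\<lambda>k t. resolvent_iterate A k t x)
                 (\<lambda>t. vf_semigroup A t x) sequentially)) \<and>
         (\<forall>x\<in>vf_dom A. \<forall>t\<ge>0. \<forall>k\<ge>1.
            dist (resolvent_iterate A k t x) (vf_semigroup A t x)
              \<le> vf_min_norm A x * (2 * t / sqrt (real k)))"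
proof -
  \<comment> \<open>Completeness turns the uniform Cauchy property into uniform convergence, and the
    limit function is the pointwise \<open>lim\<close>, that is,
    \<open>vf_semigroup\<close>.\<close>
  have unif: "uniform_limit {0..T} (\<lambda>k t. resolvent_iterate A k t x)
      (\<lambda>t. vf_semigroup A t x) sequentially" if "x \<in> closure (vf_dom A)" for x T
    using uniformly_Cauchy_resolvent_iterate[OF assms(1,3-5) that, of T]
    unfolding vf_semigroup_def
    by (simp add: Cauchy_uniformly_convergent flip: uniformly_convergent_uniform_limit_iff)
  have lim: "(\<lambda>k. resolvent_iterate A k t x) \<longlonglongrightarrow> vf_semigroup A t x"
    if "x \<in> closure (vf_dom A)" "t \<ge> 0" for x t
    using tendsto_uniform_limitI[OF unif[OF that(1), of t]] that by simp
  have bounded: "uniform_limit I (\<lambda>k t. resolvent_iterate A k t x)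
      (\<lambda>t. vf_semigroup A t x) sequentially"
    if "x \<in> closure (vf_dom A)" "I \<subseteq> {0..}" "bounded I" for x I
  proof -
    obtain T where "\<forall>t\<in>I. \<bar>t\<bar> \<le> T"
      using \<open>bounded I\<close> by (auto simp: bounded_iff)
    then have "I \<subseteq> {0..T}"
      using that by fastforce
    with unif[OF that(1)] show ?thesis
      by (rule uniform_limit_on_subset)
  qed
  have rate: "dist (resolvent_iterate A k t x) (vf_semigroup A t x)
      \<le> vf_min_norm A x * (2 * t / sqrt (real k))"
    if x: "x \<in> vf_dom A" and "t \<ge> 0" "k \<ge> 1" for x t k
  proof -
    have nonneg: "vf_min_norm A x \<ge> 0"
      by (rule vf_min_norm_nonneg[OF assms(1,3-5) x])
    \<comment> \<open>Letting \<open>m\<close> tend to infinity in the estimate for two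
      iterates.\<close>
    have "dist (resolvent_iterate A k t x) (vf_semigroup A t x)
        \<le> vf_min_norm A x * t * sqrt (1 / real k + 0)"
    proof (rule LIMSEQ_le)
      show "(\<lambda>m. dist (resolvent_iterate A k t x) (resolvent_iterate A m t x))
          \<longlonglongrightarrow> dist (resolvent_iterate A k t x) (vf_semigroup A t x)"
        using lim[of x t] x \<open>t \<ge> 0\<close> closure_subset by (intro tendsto_intros) auto
      show "(\<lambda>m. vf_min_norm A x * t * sqrt (1 / real k + 1 / real m))
          \<longlonglongrightarrow> vf_min_norm A x * t * sqrt (1 / real k + 0)"
        by (intro tendsto_intros lim_const_over_n)
      show "\<exists>N. \<forall>m\<ge>N. dist (resolvent_iterate A k t x) (resolvent_iterate A m t x)
          \<le> vf_min_norm A x * t * sqrt (1 / real k + 1 / real m)"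
        using dist_resolvent_iterate_le[OF assms(1,3-5)] that by blast
    qed
    \<comment> \<open>The limit yields \<open>t / sqrt k\<close>, which lies below the claimed
      \<open>2 * t / sqrt k\<close>.\<close>
    also have "\<dots> \<le> vf_min_norm A x * (2 * t / sqrt (real k))"
      using nonneg \<open>t \<ge> 0\<close> by (simp add: real_sqrt_divide divide_right_mono mult_left_mono)
    finally show ?thesis .
  qed
  show ?thesis
    using lim bounded rate by (auto simp: convergent_def)
qed

end
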